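(* Let $n,m\ge1$, let $B_0,B_1,\dots,B_m$ be $n\times n$ unitary matrices, let $\alpha_1,\dots,\alpha_m$ be complex numbers with $|\alpha_1|<|\alpha_2|<\cdots<|\alpha_m|$, and let $$T(\lambda)=-B_0+I\lambda+\frac{B_1}{\lambda-\alpha_1}+\cdots+\frac{B_m}{\lambda-\alpha_m}.$$ Let $R_2$ be the unique real positive root of $$q(x)=x-\|B_0\|_2-\frac{\|B_1\|_2}{x-|\alpha_1|}-\cdots-\frac{\|B_m\|_2}{x-|\alpha_m|}$$ such that $|\alpha_i|<R_2$ for all $i=1,\dots,m$. Then the upper bound $R_2$ for the moduli of the eigenvalues of $T(\lambda)$ is at least as good as the upper bound $\left\{\frac{(2m+1)+(4m+1)^{1/2}}{2}\right\}^{1/2}+|\alpha_m|$, that is, $$R_2\le\left\{\frac{(2m+1)+(4m+1)^{1/2}}{2}\right\}^{1/2}+|\alpha_m|.$$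
   Context: $I$ denotes the $n\times n$ identity matrix and $\|\cdot\|_2$ the spectral norm. A complex number $\lambda_0$ is an eigenvalue of the rational matrix $T(\lambda)$ if $T(\lambda_0)$ has finite entries and there is a nonzero $v\in\mathbb{C}^n$ with $T(\lambda_0)v=0$. Both quantities compared are upper bounds for $|\lambda_0|$ for every eigenvalue $\lambda_0$ of $T(\lambda)$; the claim to be proved is the inequality between them. *)

theory Defs
  imports "HOL-Analysis.Analysis"
begin

definition conj_transpose :: "complex^'n^'m \<Rightarrow> complex^'m^'n" where
  "conj_transpose A = (\<chi> i j. cnj (A $ j $ i))"

definition unitary_matrix :: "complex^'n^'n \<Rightarrow> bool" where
  "unitary_matrix U \<longleftrightarrow> conj_transpose U ** U = mat 1 \<and> U ** conj_transpose U = mat 1"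

text \<open>The norm on \<^typ>\<open>complex^'n\<close> is the Euclidean one, so the operator norm it induces
  is the spectral norm.\<close>

definition spectral_norm :: "complex^'n^'m \<Rightarrow> real" where
  "spectral_norm A = onorm ((*v) A)"

text \<open>The family \<open>B\<close> is used at the indices \<open>0, \<dots>, m\<close> and \<open>\<alpha>\<close> at \<open>1, \<dots>, m\<close>.\<close>

definition T_mat :: "nat \<Rightarrow> (nat \<Rightarrow> complex^'n^'n) \<Rightarrow> (nat \<Rightarrow> complex) \<Rightarrow> complex \<Rightarrow> complex^'n^'n" where
  "T_mat m B \<alpha> z =
     - B 0 + mat z + (\<Sum>i=1..m. (\<chi> j k. (B i $ j $ k) / (z - \<alpha> i)))"

text \<open>Division by zero yields zero in HOL, so finiteness of the entries of \<open>T(z\<^sub>0)\<close> has to be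
  required explicitly. When the \<open>\<alpha>\<^sub>i\<close> are distinct and the \<open>B\<^sub>i\<close> are nonzero (for instance
  unitary), the poles of \<open>T\<close> are exactly the points \<open>\<alpha>\<^sub>1, \<dots>, \<alpha>\<^sub>m\<close>.\<close>

definition T_eigenvalue :: "nat \<Rightarrow> (nat \<Rightarrow> complex^'n^'n) \<Rightarrow> (nat \<Rightarrow> complex) \<Rightarrow> complex \<Rightarrow> bool" where
  "T_eigenvalue m B \<alpha> z\<^sub>0 \<longleftrightarrow>
     (\<forall>i\<in>{1..m}. z\<^sub>0 \<noteq> \<alpha> i) \<and> (\<exists>v. v \<noteq> 0 \<and> T_mat m B \<alpha> z\<^sub>0 *v v = 0)"

definition q_fun :: "nat \<Rightarrow> (nat \<Rightarrow> complex^'n^'n) \<Rightarrow> (nat \<Rightarrow> complex) \<Rightarrow> real \<Rightarrow> real" where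
  "q_fun m B \<alpha> x =
     x - spectral_norm (B 0) - (\<Sum>i=1..m. spectral_norm (B i) / (x - cmod (\<alpha> i)))"

end

theory Submission
  imports Defs
begin

text \<open>
  Write \<open>p x = \<parallel>B\<^sub>0\<parallel> + (\<Sum>i=1..m. \<parallel>B\<^sub>i\<parallel> / (x - \<bar>\<alpha>\<^sub>i\<bar>))\<close>, so that \<open>R\<^sub>2\<close> is a fixed point of \<open>p\<close>,
  and note that \<open>p\<close> is decreasing to the right of all the \<open>\<bar>\<alpha>\<^sub>i\<bar>\<close>.

  An eigenvector \<open>v\<close> for \<open>z\<close> satisfies \<open>z v = B\<^sub>0 v - (\<Sum>i=1..m. B\<^sub>i v / (z - \<alpha>\<^sub>i))\<close>.
  If \<open>\<bar>z\<bar> > R\<^sub>2\<close>, then \<open>\<bar>z - \<alpha>\<^sub>i\<bar> \<ge> \<bar>z\<bar> - \<bar>\<alpha>\<^sub>i\<bar> > 0\<close>, and taking norms gives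
  \<open>\<bar>z\<bar> \<le> p \<bar>z\<bar> \<le> p R\<^sub>2 = R\<^sub>2\<close>, a contradiction
  (\<open>T_eigenvalue_cmod_le\<close>).

  Unitary matrices preserve the Euclidean norm, so every \<open>\<parallel>B\<^sub>i\<parallel>\<close> equals \<open>1\<close>
  (\<open>spectral_norm_unitary\<close>). As \<open>\<bar>\<alpha>\<^sub>m\<bar>\<close> is the largest of the \<open>\<bar>\<alpha>\<^sub>i\<bar>\<close>, the number
  \<open>y = R\<^sub>2 - \<bar>\<alpha>\<^sub>m\<bar>\<close> satisfies \<open>y \<le> R\<^sub>2 = p R\<^sub>2 \<le> 1 + m / y\<close>, that is \<open>y\<^sup>2 \<le> y + m\<close>, and
  so \<open>y\<close> is at most the positive root \<open>s = (1 + \<surd>(4 m + 1)) / 2\<close> of \<open>s\<^sup>2 = s + m\<close>.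
  The nested radical in the statement is just \<open>s\<close>: the number under the outer root
  equals \<open>s + m = s\<^sup>2\<close> (\<open>le_nested_sqrtI\<close>).
\<close>

lemma norm_vector_scalar_mult:
  fixes v :: "complex^'n"
  shows "norm (c *s v) = cmod c * norm v"
  by (simp add: norm_vec_def norm_mult L2_set_right_distrib)

lemma matrix_divide_vector_mult:
  fixes A :: "complex^'n^'m"
  shows "(\<chi> j k. A $ j $ k / c) *v v = inverse c *s (A *v v)"
  by (simp add: vec_eq_iff matrix_vector_mult_def sum_distrib_left field_simps)

lemma mat_vector_mult:
  fixes v :: "complex^'n"
  shows "mat z *v v = z *s v"
  by (simp add: vec_eq_iff matrix_vector_mult_def mat_def if_distrib if_distribR cong: if_cong)

lemma matrix_sum_vector_mult:
  fixes A :: "'i \<Rightarrow> complex^'n^'m"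
  shows "(\<Sum>i\<in>S. A i) *v v = (\<Sum>i\<in>S. A i *v v)"
  by (induction S rule: infinite_finite_induct) (simp_all add: matrix_vector_mult_add_rdistrib)

lemma norm_matrix_vector_mult_le:
  fixes A :: "complex^'n^'m"
  shows "norm (A *v v) \<le> spectral_norm A * norm v"
  unfolding spectral_norm_def by (rule onorm[OF matrix_vector_mul_bounded_linear])

lemma spectral_norm_nonneg: "0 \<le> spectral_norm A"
  unfolding spectral_norm_def by (rule onorm_pos_le[OF matrix_vector_mul_bounded_linear])

lemma of_real_norm_square:
  fixes v :: "complex^'n"
  shows "complex_of_real ((norm v)\<^sup>2) = (\<Sum>i\<in>UNIV. v $ i * cnj (v $ i))"
  by (simp add: norm_vec_def L2_set_def sum_nonneg complex_norm_square[symmetric])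

text \<open>Moving \<open>A\<close> across the Hermitian form gives \<open>\<langle>A v, w\<rangle> = \<langle>v, A\<^sup>* w\<rangle>\<close>; a unitary matrix
  therefore satisfies \<open>\<langle>U v, U v\<rangle> = \<langle>v, U\<^sup>* U v\<rangle> = \<langle>v, v\<rangle>\<close>.\<close>

lemma sum_matrix_vector_mult_cnj:
  fixes A :: "complex^'n^'m"
  shows "(\<Sum>i\<in>UNIV. (A *v v) $ i * cnj (w $ i)) =
         (\<Sum>j\<in>UNIV. v $ j * cnj ((conj_transpose A *v w) $ j))"
proof -
  have "(\<Sum>i\<in>UNIV. (A *v v) $ i * cnj (w $ i)) =
        (\<Sum>i\<in>UNIV. \<Sum>j\<in>UNIV. v $ j * (A $ i $ j * cnj (w $ i)))"
    by (simp add: matrix_vector_mult_def sum_distrib_left sum_distrib_right mult_ac)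
  also have "\<dots> = (\<Sum>j\<in>UNIV. \<Sum>i\<in>UNIV. v $ j * (A $ i $ j * cnj (w $ i)))"
    by (rule sum.swap)
  also have "\<dots> = (\<Sum>j\<in>UNIV. v $ j * cnj ((conj_transpose A *v w) $ j))"
    by (simp add: matrix_vector_mult_def conj_transpose_def sum_distrib_left)
  finally show ?thesis .
qed

lemma norm_unitary_mult:
  assumes "unitary_matrix U"
  shows "norm (U *v v) = norm v"
proof -
  have "complex_of_real ((norm (U *v v))\<^sup>2) = complex_of_real ((norm v)\<^sup>2)"
    using assms
    by (simp add: of_real_norm_square sum_matrix_vector_mult_cnj matrix_vector_mul_assoc
        unitary_matrix_def del: of_real_power)
  then show ?thesis
    unfolding of_real_eq_iff by simp
qed

lemma spectral_norm_unitary: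
  fixes U :: "complex^'n^'n"
  assumes "unitary_matrix U"
  shows "spectral_norm U = 1"
proof (rule antisym)
  show "spectral_norm U \<le> 1"
    unfolding spectral_norm_def by (rule onorm_bound) (simp_all add: norm_unitary_mult assms)
  have "norm (axis undefined 1 :: complex^'n) = 1"
    by simp
  then show "1 \<le> spectral_norm U"
    using norm_matrix_vector_mult_le[of U "axis undefined 1"] by (simp add: norm_unitary_mult assms)
qed

lemma T_mat_vector_mult:
  "T_mat m B \<alpha> z *v v =
   z *s v - (B 0 *v v - (\<Sum>i=1..m. inverse (z - \<alpha> i) *s (B i *v v)))"
  by (simp add: T_mat_def matrix_vector_mult_add_rdistrib matrix_vector_mult_diff_rdistrib
      mat_vector_mult matrix_sum_vector_mult matrix_divide_vector_mult)

lemma T_eigenvalue_cmod_le: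
  assumes root: "q_fun m B \<alpha> R = 0"
    and R: "\<forall>i\<in>{1..m}. cmod (\<alpha> i) < R"
    and eig: "T_eigenvalue m B \<alpha> z"
  shows "cmod z \<le> R"
proof (rule ccontr)
  assume "\<not> cmod z \<le> R"
  then have zR: "R < cmod z" by simp
  from eig obtain v where "v \<noteq> 0" and "T_mat m B \<alpha> z *v v = 0"
    unfolding T_eigenvalue_def by blast
  then have zv: "z *s v = B 0 *v v - (\<Sum>i=1..m. inverse (z - \<alpha> i) *s (B i *v v))"
    by (simp add: T_mat_vector_mult)
  have summand: "norm (inverse (z - \<alpha> i) *s (B i *v v))
      \<le> spectral_norm (B i) / (R - cmod (\<alpha> i)) * norm v" if "i \<in> {1..m}" for i
  proof -
    have gap: "0 < R - cmod (\<alpha> i)" using R that by simp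
    have "R - cmod (\<alpha> i) \<le> cmod (z - \<alpha> i)"
      using zR norm_triangle_ineq2[of z "\<alpha> i"] by linarith
    then have "norm (B i *v v) / cmod (z - \<alpha> i)
        \<le> (spectral_norm (B i) * norm v) / (R - cmod (\<alpha> i))"
      using gap norm_matrix_vector_mult_le[of "B i" v]
      by (intro frac_le) (auto simp: spectral_norm_nonneg)
    then show ?thesis
      by (simp add: norm_vector_scalar_mult norm_inverse divide_inverse mult_ac)
  qed
  have "cmod z * norm v = norm (B 0 *v v - (\<Sum>i=1..m. inverse (z - \<alpha> i) *s (B i *v v)))"
    using zv by (metis norm_vector_scalar_mult)
  also have "\<dots> \<le> norm (B 0 *v v) + norm (\<Sum>i=1..m. inverse (z - \<alpha> i) *s (B i *v v))"
    by (rule norm_triangle_ineq4)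
  also have "\<dots> \<le> spectral_norm (B 0) * norm v
      + (\<Sum>i=1..m. spectral_norm (B i) / (R - cmod (\<alpha> i)) * norm v)"
    by (intro add_mono norm_matrix_vector_mult_le sum_norm_le summand)
  also have "\<dots> = R * norm v"
    using root unfolding q_fun_def sum_distrib_right[symmetric] distrib_right[symmetric]
    by simp
  finally show False
    using zR \<open>v \<noteq> 0\<close> by simp
qed

lemma le_nested_sqrtI:
  fixes a y :: real
  assumes "0 \<le> a" and "y\<^sup>2 \<le> y + a"
  shows "y \<le> sqrt (((2 * a + 1) + sqrt (4 * a + 1)) / 2)"
proof -
  define s where "s = (1 + sqrt (4 * a + 1)) / 2"
  have "s \<ge> 0" and s2: "s\<^sup>2 = ((2 * a + 1) + sqrt (4 * a + 1)) / 2"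
    using \<open>0 \<le> a\<close> by (simp_all add: s_def power2_eq_square field_simps)
  \<comment> \<open>Completing the square in the hypothesis.\<close>
  have "(2 * y - 1)\<^sup>2 \<le> 4 * a + 1"
    using assms(2) by (simp add: power2_eq_square algebra_simps)
  then have "2 * y - 1 \<le> sqrt (4 * a + 1)"
    by (rule real_le_rsqrt)
  then have "y \<le> s"
    by (simp add: s_def)
  also have "s = sqrt (s\<^sup>2)"
    using \<open>s \<ge> 0\<close> by simp
  finally show ?thesis
    by (simp add: s2)
qed

theorem theorem3p1:
  fixes m :: nat
    and B :: "nat \<Rightarrow> complex^'n^'n"
    and \<alpha> :: "nat \<Rightarrow> complex"
    and R\<^sub>2 :: real
  assumes "m \<ge> 1"
    and "\<forall>i\<in>{0..m}. unitary_matrix (B i)"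
    and "strict_mono_on {1..m} (\<lambda>i. cmod (\<alpha> i))"
    and "R\<^sub>2 > 0"
    and "q_fun m B \<alpha> R\<^sub>2 = 0"
    and "\<forall>i\<in>{1..m}. cmod (\<alpha> i) < R\<^sub>2"
  shows "(\<forall>z\<^sub>0. T_eigenvalue m B \<alpha> z\<^sub>0 \<longrightarrow> cmod z\<^sub>0 \<le> R\<^sub>2) \<and>
         R\<^sub>2 \<le> sqrt (((2 * real m + 1) + sqrt (4 * real m + 1)) / 2) + cmod (\<alpha> m)"
proof
  show "\<forall>z\<^sub>0. T_eigenvalue m B \<alpha> z\<^sub>0 \<longrightarrow> cmod z\<^sub>0 \<le> R\<^sub>2"
    using T_eigenvalue_cmod_le assms(5,6) by blast
next
  define y where "y = R\<^sub>2 - cmod (\<alpha> m)"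
  have "y > 0"
    using assms(1,6) by (simp add: y_def)
  have "R\<^sub>2 = 1 + (\<Sum>i=1..m. 1 / (R\<^sub>2 - cmod (\<alpha> i)))"
    using assms(2,5) by (simp add: q_fun_def spectral_norm_unitary)
  also have "(\<Sum>i=1..m. 1 / (R\<^sub>2 - cmod (\<alpha> i))) \<le> (\<Sum>i=1..m. 1 / y)"
  proof (intro sum_mono frac_le)
    fix i assume "i \<in> {1..m}"
    then have "cmod (\<alpha> i) \<le> cmod (\<alpha> m)"
      using strict_mono_on_leD[OF assms(3), of i m] assms(1) by simp
    then show "y \<le> R\<^sub>2 - cmod (\<alpha> i)"
      by (simp add: y_def)
  qed (use \<open>y > 0\<close> in simp_all)
  also have "(\<Sum>i=1..m. 1 / y) = m / y"
    by simp
  finally have "R\<^sub>2 \<le> 1 + m / y"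
    by simp
  moreover have "y \<le> R\<^sub>2"
    by (simp add: y_def)
  ultimately have "y \<le> 1 + m / y"
    by linarith
  then have "y\<^sup>2 \<le> y + m"
    using \<open>y > 0\<close> by (simp add: power2_eq_square field_simps)
  then show "R\<^sub>2 \<le> sqrt (((2 * real m + 1) + sqrt (4 * real m + 1)) / 2) + cmod (\<alpha> m)"
    using le_nested_sqrtI[of "real m" y] by (simp add: y_def)
qed

end
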